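(* Let $\hat\gamma:2\pi\mathbb{T}\to(0,\infty)$ be of class $C^2$ and satisfy $3\hat\gamma(\theta)-\hat\gamma(\theta-\pi)\ge0$ for all $\theta\in2\pi\mathbb{T}$. Then the minimal stabilizing function $$k_0(\theta)=\inf\left\{\alpha\ge0\;\middle|\;4\hat\gamma(\theta)P_\alpha(\phi,\theta)\ge Q^2(\phi,\theta)\ \ \forall\phi\in2\pi\mathbb{T}\right\}$$ is well-defined (the set is nonempty for every $\theta\in 2\pi\mathbb{T}$), and for every $\theta\in2\pi\mathbb{T}$ $$k_0(\theta)\le\frac{1}{4\hat\gamma(\theta)}\left[A^2(\theta)+4\hat\gamma(\theta)A(\theta)+4|\hat\gamma'(\theta)|^2\right]<\infty,$$ where $$A(\theta)=\frac{\pi^2}{8}\left(5\sup_{2\pi\mathbb{T}}|\hat\gamma''|+5|\hat\gamma'(\theta)|+\hat\gamma(\theta)\right).$$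
   Context: $2\pi\mathbb{T}=\mathbb{R}/2\pi\mathbb{Z}$; functions on it are $2\pi$-periodic functions on $\mathbb{R}$. For $\alpha\ge0$ and $\phi,\theta\in2\pi\mathbb{T}$, $$P_\alpha(\phi,\theta)=\hat\gamma(\theta)-\hat\gamma'(\theta)\sin2\phi+\alpha\sin^2\phi,\qquad Q(\phi,\theta)=\hat\gamma(\theta-\phi)+\hat\gamma(\theta)\cos\phi-\hat\gamma'(\theta)\sin\phi.$$ *)

theory Defs
  imports "HOL-Analysis.Analysis"
begin

text \<open>
  Functions on \<open>\<real> / 2\<pi>\<int>\<close> are represented as \<open>2\<pi>\<close>-periodic functions on the reals; the
  angles \<open>\<phi>\<close> and \<open>\<theta>\<close> accordingly range over all reals.
\<close>

definition periodic_2pi :: "(real \<Rightarrow> real) \<Rightarrow> bool" where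
  "periodic_2pi f \<longleftrightarrow> (\<forall>x. f (x + 2 * pi) = f x)"

definition class_C2 :: "(real \<Rightarrow> real) \<Rightarrow> bool" where
  "class_C2 f \<longleftrightarrow> f differentiable_on UNIV \<and> deriv f differentiable_on UNIV
     \<and> continuous_on UNIV (deriv (deriv f))"

definition P :: "(real \<Rightarrow> real) \<Rightarrow> real \<Rightarrow> real \<Rightarrow> real \<Rightarrow> real" where
  "P \<gamma> \<alpha> \<phi> \<theta> = \<gamma> \<theta> - deriv \<gamma> \<theta> * sin (2 * \<phi>) + \<alpha> * (sin \<phi>)\<^sup>2"

definition Q :: "(real \<Rightarrow> real) \<Rightarrow> real \<Rightarrow> real \<Rightarrow> real" where
  "Q \<gamma> \<phi> \<theta> = \<gamma> (\<theta> - \<phi>) + \<gamma> \<theta> * cos \<phi> - deriv \<gamma> \<theta> * sin \<phi>"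

definition stabilizing_set :: "(real \<Rightarrow> real) \<Rightarrow> real \<Rightarrow> real set" where
  "stabilizing_set \<gamma> \<theta> = {\<alpha>. \<alpha> \<ge> 0 \<and> (\<forall>\<phi>. 4 * \<gamma> \<theta> * P \<gamma> \<alpha> \<phi> \<theta> \<ge> (Q \<gamma> \<phi> \<theta>)\<^sup>2)}"

text \<open>
  The infimum is taken in the reals, so it is only meaningful when the set is nonempty
  (it is always bounded below by 0).
\<close>

definition k0 :: "(real \<Rightarrow> real) \<Rightarrow> real \<Rightarrow> real" where
  "k0 \<gamma> \<theta> = Inf (stabilizing_set \<gamma> \<theta>)"

text \<open>
  Likewise the supremum below is real-valued, hence only meaningful when \<open>\<bar>\<gamma>''\<bar>\<close> is bounded.
\<close>

definition A :: "(real \<Rightarrow> real) \<Rightarrow> real \<Rightarrow> real" where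
  "A \<gamma> \<theta> = pi\<^sup>2 / 8 *
     (5 * (SUP t. \<bar>deriv (deriv \<gamma>) t\<bar>) + 5 * \<bar>deriv \<gamma> \<theta>\<bar> + \<gamma> \<theta>)"

end

theory Submission
  imports Defs
begin

text \<open>
  Fix \<open>\<theta>\<close> and write \<open>g = \<gamma> \<theta>\<close>, \<open>d = \<gamma>' \<theta>\<close>, \<open>s = sin \<phi>\<close>, \<open>c = cos \<phi>\<close>. The candidate
  \<open>\<alpha> = (A\<^sup>2 + 4 g A + 4 d\<^sup>2) / (4 g)\<close>, whose value is the claimed bound on \<open>k0\<close>, turns
  \<open>4 g P\<close> into \<open>4 g\<^sup>2 - 8 g d s c + (A\<^sup>2 + 4 g A + 4 d\<^sup>2) s\<^sup>2\<close>. It has to be shown that this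
  \<open>\<alpha>\<close> lies in the stabilizing set.

  The point is that \<open>X = 2 g - 2 d s c\<close> is almost a square root of \<open>4 g P\<close>: the inequality
  \<open>(\<bar>X\<bar> + A s\<^sup>2)\<^sup>2 \<le> 4 g P\<close> holds for every \<open>A \<ge> 0\<close> (\<open>square_le_of_abs_le\<close>; after
  \<open>\<bar>X\<bar> \<le> 2 g + 2 \<bar>d s c\<bar>\<close> in the cross term, what is left over is the perfect square
  \<open>(2 \<bar>d\<bar> s\<^sup>2 - A \<bar>s c\<bar>)\<^sup>2\<close>). So it suffices to bound \<open>\<bar>Q\<bar>\<close> by
  \<open>\<bar>X\<bar> + A s\<^sup>2\<close>, a first-order comparison that can only be delicate where \<open>s\<close> vanishes,
  that is, at the multiples of \<open>\<pi>\<close>.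

  Write \<open>\<phi> = x + m \<pi>\<close> with \<open>\<bar>x\<bar> \<le> \<pi>/2\<close>. For even \<open>m\<close>, a second-order Taylor expansion of
  \<open>\<gamma> (\<theta> - x)\<close> shows that \<open>Q\<close> and \<open>X\<close> agree to first order (\<open>Q_bound_near_zero\<close>). For odd \<open>m\<close>
  the value \<open>\<gamma> (\<theta> - x - \<pi>)\<close> is not determined by data at \<open>\<theta>\<close>, but the hypothesis, applied
  at \<open>\<theta> - x\<close> rather than at \<open>\<theta>\<close>, bounds it by \<open>3 \<gamma> (\<theta> - x)\<close>, and the Taylor expansion of
  this majorant again matches \<open>X\<close> to first order; positivity of \<open>\<gamma>\<close> controls \<open>Q\<close> from below
  (\<open>Q_bound_near_pi\<close>). The Taylor remainders are \<open>O(x\<^sup>2)\<close>, and become \<open>O(s\<^sup>2)\<close> by elementary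
  estimates on \<open>[-\<pi>/2, \<pi>/2]\<close>.
\<close>

section \<open>Trigonometric estimates on a half period\<close>

text \<open>
  This is \<open>\<bar>y\<bar> \<le> \<bar>tan y\<bar>\<close> at \<open>y = x / 2\<close>. It serves both to dominate \<open>x\<^sup>2\<close> by \<open>sin\<^sup>2 x\<close>
  and to show that \<open>x - sin x\<close> is of second order.
\<close>

lemma abs_mult_one_plus_cos_le:
  fixes x :: real
  assumes "\<bar>x\<bar> \<le> pi / 2"
  shows "\<bar>x\<bar> * (1 + cos x) \<le> 2 * \<bar>sin x\<bar>"
proof -
  have c: "cos x \<ge> 0"
    using assms by (intro cos_ge_zero) auto
  have "\<bar>x / 2\<bar> < pi / 2"
    using assms pi_gt_zero by linarith
  then have "\<bar>x / 2\<bar> \<le> \<bar>tan (x / 2)\<bar>"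
    by (rule abs_tan_ge)
  moreover have "tan (x / 2) = sin x / (cos x + 1)"
    using tan_half[of "x / 2"] by simp
  ultimately have "\<bar>x\<bar> / 2 \<le> \<bar>sin x\<bar> / (1 + cos x)"
    using c by (simp add: abs_divide add.commute)
  with c show ?thesis
    by (simp add: field_simps)
qed

lemma one_minus_cos_le_sin_squared:
  fixes x :: real
  assumes "cos x \<ge> 0"
  shows "1 - cos x \<le> (sin x)\<^sup>2"
proof -
  have "(sin x)\<^sup>2 = (1 - cos x) * (1 + cos x)"
    by (simp add: sin_squared_eq power2_eq_square algebra_simps)
  also have "\<dots> \<ge> (1 - cos x) * 1"
    using assms by (intro mult_left_mono) auto
  finally show ?thesis
    by simp
qed

lemma square_le_four_sin_squared:
  fixes x :: real
  assumes "\<bar>x\<bar> \<le> pi / 2"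
  shows "x\<^sup>2 \<le> 4 * (sin x)\<^sup>2"
proof -
  have "cos x \<ge> 0"
    using assms by (intro cos_ge_zero) auto
  then have "\<bar>x\<bar> * 1 \<le> \<bar>x\<bar> * (1 + cos x)"
    by (intro mult_left_mono) auto
  with abs_mult_one_plus_cos_le[OF assms] have "\<bar>x\<bar> \<le> \<bar>2 * sin x\<bar>"
    by (simp add: abs_mult)
  then have "x\<^sup>2 \<le> (2 * sin x)\<^sup>2"
    by (simp only: abs_le_square_iff)
  then show ?thesis
    by (simp add: power_mult_distrib)
qed

lemma abs_diff_sin_le_sin_squared:
  fixes x :: real
  assumes "\<bar>x\<bar> \<le> pi / 2"
  shows "\<bar>x - sin x\<bar> \<le> (sin x)\<^sup>2"
proof -
  have c: "cos x \<ge> 0"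
    using assms by (intro cos_ge_zero) auto
  have "\<bar>x - sin x\<bar> = \<bar>x\<bar> - \<bar>sin x\<bar>"
  proof (cases "x \<ge> 0")
    case True
    then have "sin x \<ge> 0"
      using assms by (intro sin_ge_zero) auto
    with True sin_x_le_x[OF True] show ?thesis
      by simp
  next
    case False
    then have "sin (- x) \<ge> 0"
      using assms by (intro sin_ge_zero) auto
    moreover have "sin (- x) \<le> - x"
      using False by (intro sin_x_le_x) auto
    ultimately show ?thesis
      using False by simp
  qed
  also have "\<dots> \<le> 1 - cos x"
  proof -
    have "(\<bar>x\<bar> - \<bar>sin x\<bar>) * (1 + cos x) \<le> \<bar>sin x\<bar> * (1 - cos x)"
      using abs_mult_one_plus_cos_le[OF assms] by (simp add: algebra_simps)
    also have "\<dots> \<le> 1 * (1 - cos x)"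
      by (intro mult_right_mono) auto
    also have "\<dots> \<le> (1 - cos x) * (1 + cos x)"
      using c mult_left_mono[of 1 "1 + cos x" "1 - cos x"] by simp
    finally show ?thesis
      using c by simp
  qed
  also have "\<dots> \<le> (sin x)\<^sup>2"
    using c by (rule one_minus_cos_le_sin_squared)
  finally show ?thesis .
qed

lemma abs_sin_diff_sin_cos_le:
  fixes x :: real
  assumes "cos x \<ge> 0"
  shows "\<bar>sin x - sin x * cos x\<bar> \<le> (sin x)\<^sup>2"
proof -
  have "sin x - sin x * cos x = sin x * (1 - cos x)"
    by (simp add: algebra_simps)
  then have "\<bar>sin x - sin x * cos x\<bar> = \<bar>sin x\<bar> * (1 - cos x)"
    by (simp add: abs_mult)
  also have "\<dots> \<le> 1 * (1 - cos x)"
    by (intro mult_right_mono) auto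
  finally show ?thesis
    using one_minus_cos_le_sin_squared[OF assms] by simp
qed

section \<open>The quadratic inequality\<close>

text \<open>
  Here \<open>s\<close> and \<open>c\<close> stand for the sine and cosine of one angle. Expanding the square of the
  bound on \<open>q\<close>, the cross term is at most \<open>(4 g + 4 \<bar>d\<bar> \<bar>s c\<bar>) a s\<^sup>2\<close>, and the part with \<open>d\<close> is
  absorbed by \<open>4 d\<^sup>2 s\<^sup>4 + a\<^sup>2 s\<^sup>2 c\<^sup>2\<close>, which is exactly what remains of \<open>4 d\<^sup>2 s\<^sup>2 + a\<^sup>2 s\<^sup>2\<close>
  once the terms \<open>4 d\<^sup>2 s\<^sup>2 c\<^sup>2\<close> and \<open>a\<^sup>2 s\<^sup>4\<close> of the square are subtracted.
\<close>

lemma square_le_of_abs_le: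
  fixes a c d g q s :: real
  assumes "a \<ge> 0" "g \<ge> 0" and sc: "s\<^sup>2 + c\<^sup>2 = 1"
    and q: "\<bar>q\<bar> \<le> \<bar>2 * g - 2 * d * s * c\<bar> + a * s\<^sup>2"
  shows "q\<^sup>2 \<le> 4 * g\<^sup>2 - 8 * g * d * s * c + (a\<^sup>2 + 4 * g * a + 4 * d\<^sup>2) * s\<^sup>2"
proof -
  define X where "X = 2 * g - 2 * d * s * c"
  define t where "t = \<bar>d\<bar> * \<bar>s * c\<bar>"
  have cross: "2 * \<bar>X\<bar> * (a * s\<^sup>2) \<le> (4 * g + 4 * t) * (a * s\<^sup>2)"
  proof (rule mult_right_mono)
    have "\<bar>X\<bar> \<le> \<bar>2 * g\<bar> + \<bar>2 * d * s * c\<bar>"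
      unfolding X_def by (rule abs_triangle_ineq4)
    then show "2 * \<bar>X\<bar> \<le> 4 * g + 4 * t"
      using assms by (simp add: t_def abs_mult mult.assoc)
  qed (use assms in simp)
  have "0 \<le> (2 * \<bar>d\<bar> * s\<^sup>2 - a * \<bar>s * c\<bar>)\<^sup>2"
    by simp
  also have "\<dots> = 4 * d\<^sup>2 * s\<^sup>2 * s\<^sup>2 + a\<^sup>2 * s\<^sup>2 * c\<^sup>2 - 4 * t * (a * s\<^sup>2)"
    by (simp add: t_def power2_diff power_mult_distrib flip: power_mult)
  finally have absorb: "4 * t * (a * s\<^sup>2) \<le> 4 * d\<^sup>2 * s\<^sup>2 * s\<^sup>2 + a\<^sup>2 * s\<^sup>2 * c\<^sup>2"
    by simp
  have "q\<^sup>2 \<le> (\<bar>X\<bar> + a * s\<^sup>2)\<^sup>2"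
    using q power_mono[of "\<bar>q\<bar>" "\<bar>X\<bar> + a * s\<^sup>2" 2] by (simp add: X_def)
  also have "\<dots> = X\<^sup>2 + 2 * \<bar>X\<bar> * (a * s\<^sup>2) + a\<^sup>2 * s\<^sup>2 * s\<^sup>2"
    by (simp add: power2_eq_square algebra_simps)
  also have "\<dots> \<le> X\<^sup>2 + 4 * g * (a * s\<^sup>2)
      + (4 * d\<^sup>2 * s\<^sup>2 * s\<^sup>2 + a\<^sup>2 * s\<^sup>2 * c\<^sup>2) + a\<^sup>2 * s\<^sup>2 * s\<^sup>2"
    using cross absorb unfolding distrib_right by linarith
  also have "\<dots> = 4 * g\<^sup>2 - 8 * g * d * s * c + 4 * g * (a * s\<^sup>2)
      + (4 * d\<^sup>2 * s\<^sup>2 + a\<^sup>2 * s\<^sup>2) * (s\<^sup>2 + c\<^sup>2)"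
    unfolding X_def by algebra
  finally show ?thesis
    unfolding sc by (simp add: algebra_simps)
qed

section \<open>First-order comparison near the zeros of the sine\<close>

text \<open>
  The linear terms \<open>- d x - d sin x\<close> of \<open>Q\<close> and \<open>- 2 d sin x cos x\<close> of \<open>X\<close> agree up to
  \<open>3 \<bar>d\<bar> sin\<^sup>2 x\<close>, since \<open>x\<close> and \<open>sin x cos x\<close> both differ from \<open>sin x\<close> by at most \<open>sin\<^sup>2 x\<close>.
\<close>

lemma Q_bound_near_zero:
  fixes d f g M x :: real
  assumes x: "\<bar>x\<bar> \<le> pi / 2" and "g \<ge> 0" "M \<ge> 0"
    and f: "\<bar>f - (g - d * x)\<bar> \<le> M / 2 * x\<^sup>2"
  shows "\<bar>f + g * cos x - d * sin x\<bar>
    \<le> \<bar>2 * g - 2 * d * sin x * cos x\<bar> + (2 * M + 3 * \<bar>d\<bar> + g) * (sin x)\<^sup>2"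
proof -
  define s c where "s = sin x" and "c = cos x"
  have c: "cos x \<ge> 0"
    using x by (intro cos_ge_zero) auto
  have "\<bar>x + s - 2 * (s * c)\<bar> \<le> 3 * s\<^sup>2"
    using abs_diff_sin_le_sin_squared[OF x] abs_sin_diff_sin_cos_le[OF c]
    unfolding s_def c_def by linarith
  then have "\<bar>d\<bar> * \<bar>x + s - 2 * (s * c)\<bar> \<le> \<bar>d\<bar> * (3 * s\<^sup>2)"
    by (intro mult_left_mono) auto
  then have lin: "\<bar>d * (x + s - 2 * (s * c))\<bar> \<le> \<bar>d\<bar> * (3 * s\<^sup>2)"
    by (simp add: abs_mult)
  have "M / 2 * x\<^sup>2 \<le> M / 2 * (4 * s\<^sup>2)"
    using square_le_four_sin_squared[OF x] assms unfolding s_def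
    by (intro mult_left_mono) auto
  then have rem: "\<bar>f - (g - d * x)\<bar> \<le> 2 * M * s\<^sup>2"
    using f by simp
  have "g * (1 - c) \<le> g * s\<^sup>2"
    using one_minus_cos_le_sin_squared[OF c] assms unfolding s_def c_def
    by (intro mult_left_mono) auto
  moreover have "g * (1 - c) \<ge> 0"
    using assms by (simp add: c_def)
  ultimately have g: "\<bar>g * (1 - c)\<bar> \<le> g * s\<^sup>2"
    by simp
  have "f + g * c - d * s
      = (2 * g - 2 * d * s * c) + (f - (g - d * x)) - g * (1 - c) - d * (x + s - 2 * (s * c))"
    by (simp add: algebra_simps)
  then have "\<bar>f + g * c - d * s\<bar> \<le> \<bar>2 * g - 2 * d * s * c\<bar>
      + (2 * M * s\<^sup>2 + \<bar>d\<bar> * (3 * s\<^sup>2) + g * s\<^sup>2)"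
    using lin rem g by linarith
  then show ?thesis
    by (simp add: s_def c_def algebra_simps)
qed

text \<open>
  Here \<open>f\<close> is the value of \<open>\<gamma>\<close> half a period away from the expansion point, which explains the
  changed signs of the sine and the cosine. The upper bound on \<open>f\<close> gives the upper estimate as
  before. For the lower estimate no comparison with \<open>Q\<close> to first order is possible, but
  \<open>f \<ge> 0\<close> leaves a margin of size \<open>g\<close>, which is enough.
\<close>

lemma Q_bound_near_pi:
  fixes d f g M x :: real
  assumes x: "\<bar>x\<bar> \<le> pi / 2" and "g \<ge> 0" "M \<ge> 0" "f \<ge> 0"
    and f: "f \<le> 3 * (g - d * x + M / 2 * x\<^sup>2)"
  shows "\<bar>f - g * cos x + d * sin x\<bar>
    \<le> \<bar>2 * g - 2 * d * sin x * cos x\<bar> + (6 * M + 5 * \<bar>d\<bar> + g) * (sin x)\<^sup>2"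
proof -
  define s c where "s = sin x" and "c = cos x"
  have c: "cos x \<ge> 0"
    using x by (intro cos_ge_zero) auto
  have c': "1 - c \<le> s\<^sup>2" "c \<le> 1" "0 \<le> c"
    using one_minus_cos_le_sin_squared[OF c] c by (simp_all add: s_def c_def)
  have Ms: "0 \<le> M * s\<^sup>2" and gs: "0 \<le> g * s\<^sup>2" and ds: "0 \<le> \<bar>d\<bar> * s\<^sup>2"
    using assms by simp_all
  have upper: "f - g * c + d * s
      \<le> (2 * g - 2 * d * s * c) + (6 * M * s\<^sup>2 + \<bar>d\<bar> * (5 * s\<^sup>2) + g * s\<^sup>2)"
  proof -
    have "\<bar>3 * x - s - 2 * (s * c)\<bar> \<le> 5 * s\<^sup>2"
      using abs_diff_sin_le_sin_squared[OF x] abs_sin_diff_sin_cos_le[OF c]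
      unfolding s_def c_def by linarith
    then have "\<bar>d\<bar> * \<bar>3 * x - s - 2 * (s * c)\<bar> \<le> \<bar>d\<bar> * (5 * s\<^sup>2)"
      by (intro mult_left_mono) auto
    then have lin: "\<bar>d * (3 * x - s - 2 * (s * c))\<bar> \<le> \<bar>d\<bar> * (5 * s\<^sup>2)"
      by (simp add: abs_mult)
    have "M / 2 * x\<^sup>2 \<le> M / 2 * (4 * s\<^sup>2)"
      using square_le_four_sin_squared[OF x] assms unfolding s_def
      by (intro mult_left_mono) auto
    then have rem: "f \<le> 3 * g - 3 * (d * x) + 6 * M * s\<^sup>2"
      using f by (simp add: algebra_simps)
    have g: "g * (1 - c) \<le> g * s\<^sup>2"
      using c' assms by (intro mult_left_mono) auto
    have "f - g * c + d * s = (2 * g - 2 * d * s * c) + (f - (3 * g - 3 * (d * x)))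
        + g * (1 - c) - d * (3 * x - s - 2 * (s * c))"
      by (simp add: algebra_simps)
    then show ?thesis
      using lin rem g by linarith
  qed
  have "g * c \<le> g"
    using c' assms by (intro mult_left_le) auto
  have lower: "g * c - d * s
      \<le> \<bar>2 * g - 2 * d * s * c\<bar> + (6 * M * s\<^sup>2 + \<bar>d\<bar> * (5 * s\<^sup>2) + g * s\<^sup>2)"
  proof (cases "d * s \<ge> 0")
    case True
    have "d * s * c \<le> d * s"
      using c' True by (intro mult_left_le) auto
    show ?thesis
    proof (cases "d * s \<le> g")
      case True
      with \<open>d * s * c \<le> d * s\<close> \<open>g * c \<le> g\<close> have "g * c - d * s \<le> 2 * g - 2 * d * s * c"
        using \<open>d * s \<ge> 0\<close> by linarith
      then show ?thesis
        using Ms gs ds by linarith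
    next
      case False
      then show ?thesis
        using \<open>g * c \<le> g\<close> Ms gs ds by linarith
    qed
  next
    case False
    \<comment> \<open>Where \<open>2 c < 1\<close>, the deficit \<open>- d s (1 - 2 c)\<close> is paid for by the term \<open>\<bar>d\<bar> s\<^sup>2\<close>.\<close>
    have "(- (d * s)) * (1 - 2 * c) \<le> \<bar>d\<bar> * s\<^sup>2"
    proof (cases "1 - 2 * c \<ge> 0")
      case True
      have "- (d * s) \<le> \<bar>d\<bar> * \<bar>s\<bar>"
        by (simp flip: abs_mult)
      also have "\<dots> \<le> \<bar>d\<bar>"
        by (intro mult_left_le) (auto simp: s_def)
      finally show ?thesis
        using True c' by (intro mult_mono) auto
    next
      case 2: False
      with False have "(- (d * s)) * (1 - 2 * c) \<le> 0"
        by (intro mult_nonneg_nonpos) auto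
      with ds show ?thesis
        by linarith
    qed
    then have "g * c - d * s \<le> 2 * g - 2 * d * s * c + \<bar>d\<bar> * s\<^sup>2"
      using \<open>g * c \<le> g\<close> \<open>g \<ge> 0\<close> by (simp add: algebra_simps)
    then show ?thesis
      using Ms gs ds by linarith
  qed
  have "\<bar>f - g * c + d * s\<bar> \<le> \<bar>2 * g - 2 * d * s * c\<bar>
      + (6 * M * s\<^sup>2 + \<bar>d\<bar> * (5 * s\<^sup>2) + g * s\<^sup>2)"
    using upper lower \<open>f \<ge> 0\<close> by linarith
  then show ?thesis
    by (simp add: s_def c_def algebra_simps)
qed

section \<open>Periodic functions of class \<open>C\<^sup>2\<close>\<close>

lemma periodic_2pi_of_int:
  assumes "periodic_2pi f"
  shows "f (x + of_int n * (2 * pi)) = f x"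
proof -
  interpret periodic_fun_simple f "2 * pi"
    using assms by unfold_locales (simp add: periodic_2pi_def)
  show ?thesis
    by (rule plus_of_int)
qed

lemma periodic_2pi_deriv:
  assumes "periodic_2pi f"
  shows "periodic_2pi (deriv f)"
proof -
  have "(\<lambda>x. f (x + 2 * pi)) = f"
    using assms by (auto simp: periodic_2pi_def)
  then have "DERIV f (x + 2 * pi) :> D \<longleftrightarrow> DERIV f x :> D" for x D
    using DERIV_shift[of f D x "2 * pi"] by simp
  then show ?thesis
    by (simp add: periodic_2pi_def deriv_def)
qed

lemma bdd_above_abs_periodic_2pi:
  assumes "periodic_2pi f" "continuous_on UNIV f"
  shows "bdd_above (range (\<lambda>t. \<bar>f t\<bar>))"
proof -
  have "continuous_on {0..2 * pi} (\<lambda>t. \<bar>f t\<bar>)"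
    using assms(2) by (intro continuous_intros) (auto intro: continuous_on_subset)
  then have bdd: "bdd_above ((\<lambda>t. \<bar>f t\<bar>) ` {0..2 * pi})"
    by (intro bounded_imp_bdd_above compact_imp_bounded compact_continuous_image) auto
  have "range (\<lambda>t. \<bar>f t\<bar>) \<subseteq> (\<lambda>t. \<bar>f t\<bar>) ` {0..2 * pi}"
  proof clarify
    fix t
    define n where "n = \<lfloor>t / (2 * pi)\<rfloor>"
    define u where "u = t + of_int (- n) * (2 * pi)"
    have "of_int n \<le> t / (2 * pi)" "t / (2 * pi) < of_int n + 1"
      unfolding n_def by linarith+
    then have "u \<in> {0..2 * pi}"
      by (auto simp: u_def field_simps)
    moreover have "f u = f t"
      unfolding u_def by (rule periodic_2pi_of_int[OF assms(1)])
    ultimately show "\<bar>f t\<bar> \<in> (\<lambda>t. \<bar>f t\<bar>) ` {0..2 * pi}"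
      by (metis imageI)
  qed
  with bdd show ?thesis
    by (rule bdd_above_mono)
qed

lemma class_C2_taylor:
  assumes "class_C2 f" and M: "\<And>t. \<bar>deriv (deriv f) t\<bar> \<le> M"
  shows "\<bar>f (\<theta> - x) - (f \<theta> - deriv f \<theta> * x)\<bar> \<le> M / 2 * x\<^sup>2"
proof (cases "x = 0")
  case False
  have D: "DERIV f t :> deriv f t" "DERIV (deriv f) t :> deriv (deriv f) t" for t
    using assms(1)
    by (auto simp: class_C2_def differentiable_on_def DERIV_deriv_iff_real_differentiable)
  define diff where "diff = (\<lambda>n::nat. if n = 0 then f else if n = 1 then deriv f
    else deriv (deriv f))"
  define a b where "a = min \<theta> (\<theta> - x)" and "b = max \<theta> (\<theta> - x)"
  have "\<forall>m t. m < 2 \<and> a \<le> t \<and> t \<le> b \<longrightarrow> DERIV (diff m) t :> diff (Suc m) t"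
    using D by (auto simp: diff_def less_2_cases_iff)
  then obtain t where "f (\<theta> - x) = (\<Sum>m<2. (diff m \<theta> / fact m) * (\<theta> - x - \<theta>)^m)
      + (diff 2 t / fact 2) * (\<theta> - x - \<theta>)^2"
    using Taylor[of 2 diff f a b \<theta> "\<theta> - x"] False
    by (auto simp: a_def b_def diff_def)
  then have "f (\<theta> - x) - (f \<theta> - deriv f \<theta> * x) = deriv (deriv f) t / 2 * x\<^sup>2"
    by (simp add: diff_def numeral_2_eq_2)
  then have "\<bar>f (\<theta> - x) - (f \<theta> - deriv f \<theta> * x)\<bar> = \<bar>deriv (deriv f) t\<bar> / 2 * x\<^sup>2"
    by (simp only: abs_mult abs_divide abs_numeral abs_power2)
  also have "\<dots> \<le> M / 2 * x\<^sup>2"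
    using M[of t] by (intro mult_right_mono) auto
  finally show ?thesis .
qed simp

section \<open>The stabilizing function\<close>

text \<open>
  Reducing \<open>\<phi>\<close> modulo \<open>\<pi>\<close> to \<open>[-\<pi>/2, \<pi>/2]\<close>, the parity of the multiple of \<open>\<pi>\<close> decides which of
  the two comparisons applies. The larger of the two constants serves for both.
\<close>

lemma abs_Q_le:
  fixes \<gamma> :: "real \<Rightarrow> real"
  assumes per: "periodic_2pi \<gamma>" and pos: "\<And>t. \<gamma> t > 0" and "class_C2 \<gamma>"
    and anti: "\<And>t. 3 * \<gamma> t - \<gamma> (t - pi) \<ge> 0"
    and M: "\<And>t. \<bar>deriv (deriv \<gamma>) t\<bar> \<le> M"
  shows "\<bar>Q \<gamma> \<phi> \<theta>\<bar> \<le> \<bar>2 * \<gamma> \<theta> - 2 * deriv \<gamma> \<theta> * sin \<phi> * cos \<phi>\<bar>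
    + (6 * M + 5 * \<bar>deriv \<gamma> \<theta>\<bar> + \<gamma> \<theta>) * (sin \<phi>)\<^sup>2"
proof -
  have "M \<ge> 0"
    using M[of 0] by linarith
  have "\<gamma> \<theta> \<ge> 0"
    using pos[of \<theta>] by simp
  define m where "m = round (\<phi> / pi)"
  define x where "x = \<phi> - of_int m * pi"
  have "\<bar>of_int m - \<phi> / pi\<bar> \<le> 1 / 2"
    unfolding m_def by (rule of_int_round_abs_le)
  then have "pi * \<bar>of_int m - \<phi> / pi\<bar> \<le> pi * (1 / 2)"
    by (intro mult_left_mono) auto
  also have "pi * \<bar>of_int m - \<phi> / pi\<bar> = \<bar>pi * (of_int m - \<phi> / pi)\<bar>"
    by (simp add: abs_mult)
  also have "pi * (of_int m - \<phi> / pi) = - x"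
    by (simp add: x_def field_simps)
  finally have x: "\<bar>x\<bar> \<le> pi / 2"
    by simp
  have taylor: "\<bar>\<gamma> (\<theta> - x) - (\<gamma> \<theta> - deriv \<gamma> \<theta> * x)\<bar> \<le> M / 2 * x\<^sup>2"
    by (rule class_C2_taylor[OF \<open>class_C2 \<gamma>\<close> M])
  have sin_per: "sin (t + of_int k * (2 * pi)) = sin t"
    and cos_per: "cos (t + of_int k * (2 * pi)) = cos t" for t k
    by (intro periodic_2pi_of_int; simp add: periodic_2pi_def)+
  show ?thesis
  proof (cases "even m")
    case True
    then obtain k where "m = 2 * k"
      by blast
    then have phi: "\<phi> = x + of_int k * (2 * pi)"
      by (simp add: x_def)
    have "\<gamma> (\<theta> - \<phi>) = \<gamma> (\<theta> - x)"
      using periodic_2pi_of_int[OF per, of "\<theta> - x" "- k"] by (simp add: phi algebra_simps)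
    then have "\<bar>Q \<gamma> \<phi> \<theta>\<bar> \<le> \<bar>2 * \<gamma> \<theta> - 2 * deriv \<gamma> \<theta> * sin \<phi> * cos \<phi>\<bar>
        + (2 * M + 3 * \<bar>deriv \<gamma> \<theta>\<bar> + \<gamma> \<theta>) * (sin \<phi>)\<^sup>2"
      using Q_bound_near_zero[OF x \<open>\<gamma> \<theta> \<ge> 0\<close> \<open>M \<ge> 0\<close> taylor]
      by (simp only: Q_def phi sin_per cos_per)
    also have "(2 * M + 3 * \<bar>deriv \<gamma> \<theta>\<bar> + \<gamma> \<theta>) * (sin \<phi>)\<^sup>2
        \<le> (6 * M + 5 * \<bar>deriv \<gamma> \<theta>\<bar> + \<gamma> \<theta>) * (sin \<phi>)\<^sup>2"
      using \<open>M \<ge> 0\<close> by (intro mult_right_mono) auto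
    finally show ?thesis
      by simp
  next
    case False
    then obtain k where "m = 2 * k + 1"
      by (rule oddE)
    then have phi: "\<phi> = x + pi + of_int k * (2 * pi)"
      by (simp add: x_def algebra_simps)
    have "\<gamma> (\<theta> - \<phi>) = \<gamma> (\<theta> - x - pi)"
      using periodic_2pi_of_int[OF per, of "\<theta> - x - pi" "- k"] by (simp add: phi algebra_simps)
    also have "\<dots> \<le> 3 * \<gamma> (\<theta> - x)"
      using anti[of "\<theta> - x"] by simp
    also have "\<dots> \<le> 3 * (\<gamma> \<theta> - deriv \<gamma> \<theta> * x + M / 2 * x\<^sup>2)"
      using abs_le_D1[OF taylor] by (intro mult_left_mono) (simp_all add: algebra_simps)
    finally have "\<gamma> (\<theta> - \<phi>) \<le> 3 * (\<gamma> \<theta> - deriv \<gamma> \<theta> * x + M / 2 * x\<^sup>2)" .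
    from Q_bound_near_pi[OF x \<open>\<gamma> \<theta> \<ge> 0\<close> \<open>M \<ge> 0\<close> _ this] pos[of "\<theta> - \<phi>"]
    have "\<bar>\<gamma> (\<theta> - \<phi>) - \<gamma> \<theta> * cos x + deriv \<gamma> \<theta> * sin x\<bar>
        \<le> \<bar>2 * \<gamma> \<theta> - 2 * deriv \<gamma> \<theta> * sin x * cos x\<bar>
          + (6 * M + 5 * \<bar>deriv \<gamma> \<theta>\<bar> + \<gamma> \<theta>) * (sin x)\<^sup>2"
      by simp
    moreover have "sin \<phi> = - sin x" "cos \<phi> = - cos x"
      unfolding phi sin_per cos_per by simp_all
    ultimately show ?thesis
      by (simp add: Q_def)
  qed
qed

theorem theorem4p1:
  fixes \<gamma> :: "real \<Rightarrow> real"
  assumes "periodic_2pi \<gamma>"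
    and "\<And>\<theta>. \<gamma> \<theta> > 0"
    and "class_C2 \<gamma>"
    and "\<And>\<theta>. 3 * \<gamma> \<theta> - \<gamma> (\<theta> - pi) \<ge> 0"
  shows "(\<forall>\<theta>. stabilizing_set \<gamma> \<theta> \<noteq> {})
    \<and> bdd_above (range (\<lambda>t. \<bar>deriv (deriv \<gamma>) t\<bar>))
    \<and> (\<forall>\<theta>. k0 \<gamma> \<theta> \<le> 1 / (4 * \<gamma> \<theta>) *
          ((A \<gamma> \<theta>)\<^sup>2 + 4 * \<gamma> \<theta> * A \<gamma> \<theta> + 4 * \<bar>deriv \<gamma> \<theta>\<bar>\<^sup>2))"
proof -
  define M where "M = (SUP t. \<bar>deriv (deriv \<gamma>) t\<bar>)"
  have bdd: "bdd_above (range (\<lambda>t. \<bar>deriv (deriv \<gamma>) t\<bar>))"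
    using assms by (intro bdd_above_abs_periodic_2pi periodic_2pi_deriv) (auto simp: class_C2_def)
  have M: "\<bar>deriv (deriv \<gamma>) t\<bar> \<le> M" for t
    unfolding M_def by (rule cSUP_upper[OF UNIV_I bdd])
  have "M \<ge> 0"
    using M[of 0] by linarith
  have mem: "1 / (4 * \<gamma> \<theta>) * ((A \<gamma> \<theta>)\<^sup>2 + 4 * \<gamma> \<theta> * A \<gamma> \<theta> + 4 * \<bar>deriv \<gamma> \<theta>\<bar>\<^sup>2)
      \<in> stabilizing_set \<gamma> \<theta>" (is "?\<alpha> \<in> _") for \<theta>
  proof -
    define g d a where "g = \<gamma> \<theta>" and "d = deriv \<gamma> \<theta>" and "a = A \<gamma> \<theta>"
    have g: "g > 0"
      using assms(2) by (simp add: g_def)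
    \<comment> \<open>The comparison needs \<open>6 M\<close>; the definition of \<open>A\<close> offers \<open>5 M \<pi>\<^sup>2 / 8\<close>, so
      \<open>\<pi>\<^sup>2 / 8 \<ge> 6 / 5\<close> is required.\<close>
    have "(3.14::real)\<^sup>2 \<le> pi\<^sup>2"
      using pi_approx by (intro power_mono) auto
    then have "6 / 5 \<le> pi\<^sup>2 / 8"
      by (simp add: power2_eq_square)
    then have "6 / 5 * (5 * M + 5 * \<bar>d\<bar> + g) \<le> a"
      unfolding a_def A_def M_def[symmetric] d_def[symmetric] g_def[symmetric]
      using \<open>M \<ge> 0\<close> g by (intro mult_right_mono) auto
    then have a: "6 * M + 5 * \<bar>d\<bar> + g \<le> a"
      using g abs_ge_zero[of d] unfolding distrib_left by simp
    then have "a \<ge> 0"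
      using \<open>M \<ge> 0\<close> g by linarith
    have \<alpha>: "4 * g * ?\<alpha> = a\<^sup>2 + 4 * g * a + 4 * d\<^sup>2"
      using g by (simp add: g_def a_def d_def)
    have "?\<alpha> \<ge> 0"
      using g \<open>a \<ge> 0\<close> by (simp add: g_def a_def)
    moreover have "(Q \<gamma> \<phi> \<theta>)\<^sup>2 \<le> 4 * \<gamma> \<theta> * P \<gamma> ?\<alpha> \<phi> \<theta>" for \<phi>
    proof -
      have "(6 * M + 5 * \<bar>d\<bar> + g) * (sin \<phi>)\<^sup>2 \<le> a * (sin \<phi>)\<^sup>2"
        using a by (intro mult_right_mono) auto
      then have "\<bar>Q \<gamma> \<phi> \<theta>\<bar> \<le> \<bar>2 * g - 2 * d * sin \<phi> * cos \<phi>\<bar> + a * (sin \<phi>)\<^sup>2"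
        using abs_Q_le[OF assms M, of \<phi> \<theta>] by (simp add: g_def d_def)
      then have "(Q \<gamma> \<phi> \<theta>)\<^sup>2 \<le> 4 * g\<^sup>2 - 8 * g * d * sin \<phi> * cos \<phi>
          + (a\<^sup>2 + 4 * g * a + 4 * d\<^sup>2) * (sin \<phi>)\<^sup>2"
        using \<open>a \<ge> 0\<close> g by (intro square_le_of_abs_le) auto
      also have "\<dots> = 4 * g * P \<gamma> ?\<alpha> \<phi> \<theta>"
        unfolding \<alpha>[symmetric] P_def g_def[symmetric] d_def[symmetric] sin_double
        by (simp add: power2_eq_square algebra_simps)
      finally show ?thesis
        by (simp add: g_def)
    qed
    ultimately show ?thesis
      by (simp add: stabilizing_set_def)
  qed
  have "bdd_below (stabilizing_set \<gamma> \<theta>)" for \<theta>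
    by (rule bdd_belowI[of _ 0]) (simp add: stabilizing_set_def)
  with mem have "k0 \<gamma> \<theta> \<le> 1 / (4 * \<gamma> \<theta>) *
      ((A \<gamma> \<theta>)\<^sup>2 + 4 * \<gamma> \<theta> * A \<gamma> \<theta> + 4 * \<bar>deriv \<gamma> \<theta>\<bar>\<^sup>2)" for \<theta>
    unfolding k0_def by (intro cInf_lower) auto
  with mem bdd show ?thesis
    by blast
qed

end
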